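(* Let $P_1\in\mathbb{R}^{n_1\times n_1}$ and $P_2\in\mathbb{R}^{n_2\times n_2}$ be symmetric positive semidefinite, $A_1\in\mathbb{R}^{p_1\times n_1}$, $A_2\in\mathbb{R}^{p_2\times n_2}$, $N_1\in\mathbb{R}^{n_1\times n_2}$, $M_1\in\mathbb{R}^{p_1\times n_2}$, $q_i\in\mathbb{R}^{n_i}$, $b_i\in\mathbb{R}^{p_i}$, and define $$K_i=\begin{bmatrix} P_i & A_i^{\mathsf T} \\ A_i & 0 \end{bmatrix},\quad r_i=\begin{bmatrix} -q_i \\ b_i \end{bmatrix}\ (i=1,2),\quad C=\begin{bmatrix} N_1 \\ M_1 \end{bmatrix},\quad L=\begin{bmatrix} C & 0 \end{bmatrix}\in\mathbb{R}^{(n_1+p_1)\times(n_2+p_2)}.$$ Consider the linear system $$\begin{bmatrix} K_1 & L \\ L^{\mathsf T} & K_2 \end{bmatrix}\begin{bmatrix} w_1 \\ w_2 \end{bmatrix}=\begin{bmatrix} r_1 \\ r_2 \end{bmatrix}\qquad(\ast)$$ with unknowns $w_1\in\mathbb{R}^{n_1+p_1}$ and $w_2\in\mathbb{R}^{n_2+p_2}$. Assume $K_1$ and $K_2$ are nonsingular. Consider the block Gauss--Seidel iteration $$w_2^{(j+1)}=K_2^{-1}\big(r_2-L^{\mathsf T}w_1^{(j)}\big),\qquad w_1^{(j+1)}=K_1^{-1}\big(r_1-Lw_2^{(j+1)}\big),\qquad j=0,1,2,\dots,$$ and the matrices $$\Gamma=K_2^{-1}L^{\mathsf T}K_1^{-1}L,\qquad\widetilde\Gamma=K_1^{-1}LK_2^{-1}L^{\mathsf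 T}.$$ Then the following statements hold. (i) The system $(\ast)$ has a unique solution if and only if $1\notin\sigma(\Gamma)$. (ii) $\rho(\Gamma)=\rho(\widetilde\Gamma)$. (iii) If $1\notin\sigma(\Gamma)$ and $w^\star=(w_1^\star,w_2^\star)$ denotes the solution of $(\ast)$, the iterates satisfy, for all $j\ge0$, $$w_1^{(j+1)}-w_1^\star=\widetilde\Gamma\,(w_1^{(j)}-w_1^\star),\qquad w_2^{(j+1)}-w_2^\star=-K_2^{-1}L^{\mathsf T}(w_1^{(j)}-w_1^\star).$$ The iteration then converges to $w^\star$ from every initialization $w_1^{(0)}$ if and only if $\rho(\Gamma)<1$. Moreover, $$\|w_1^{(j)}-w_1^\star\|\le\|\widetilde\Gamma^{\,j}\|\,\|w_1^{(0)}-w_1^\star\|,$$ and $\|\widetilde\Gamma^{\,j}\|^{1/j}\to\rho(\Gamma)$ as $j\to\infty$.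
   Context: $\sigma(X)$ denotes the spectrum (set of complex eigenvalues) and $\rho(X)$ the spectral radius of a square matrix $X$. $\|\cdot\|$ denotes an arbitrary vector norm and the matrix norm it induces. The system $(\ast)$ is the KKT system, with $w_1=(x,\lambda_1)$ and $w_2=(\xi,\lambda_2)$, of the program $\min_{x,\xi}\ \tfrac12x^{\mathsf T}P_1x+(q_1+N_1\xi)^{\mathsf T}x+\tfrac12\xi^{\mathsf T}P_2\xi+q_2^{\mathsf T}\xi$ subject to $A_1x+M_1\xi=b_1$, $A_2\xi=b_2$. *)

theory Defs
  imports "Jordan_Normal_Form.Spectral_Radius" "Jordan_Normal_Form.Gauss_Jordan_Elimination"
begin

definition psd_mat :: "nat \<Rightarrow> real mat \<Rightarrow> bool" where
  "psd_mat n P \<longleftrightarrow> P \<in> carrier_mat n n \<and> transpose_mat P = P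
     \<and> (\<forall>x \<in> carrier_vec n. x \<bullet> (P *\<^sub>v x) \<ge> 0)"

(* Junk value on singular matrices; mat_inv_inverse below covers the nonsingular case. *)
definition mat_inv :: "real mat \<Rightarrow> real mat" where
  "mat_inv A = the (mat_inverse A)"

lemma mat_inv_inverse:
  assumes A: "A \<in> carrier_mat n n" and inv: "invertible_mat A"
  shows "mat_inv A \<in> carrier_mat n n" "A * mat_inv A = 1\<^sub>m n" "mat_inv A * A = 1\<^sub>m n"
proof -
  from inv obtain B where AB: "A * B = 1\<^sub>m (dim_row A)" and BA: "B * A = 1\<^sub>m (dim_row B)"
    unfolding invertible_mat_def inverts_mat_def by auto
  have "dim_col (A * B) = n" "dim_col (B * A) = dim_row B"
    using A AB BA by auto
  hence B: "B \<in> carrier_mat n n" using A by auto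
  have "A \<in> Units (ring_mat TYPE(real) n ())"
    unfolding Units_def ring_mat_def using A B AB BA by auto
  then obtain C where C: "mat_inverse A = Some C"
    using mat_inverse(1)[OF A, of "()"] by (cases "mat_inverse A") auto
  show "mat_inv A \<in> carrier_mat n n" "A * mat_inv A = 1\<^sub>m n" "mat_inv A * A = 1\<^sub>m n"
    using mat_inverse(2)[OF A C] C unfolding mat_inv_def by auto
qed

definition kkt_mat :: "real mat \<Rightarrow> real mat \<Rightarrow> real mat" where
  "kkt_mat P A = four_block_mat P (transpose_mat A) A (0\<^sub>m (dim_row A) (dim_row A))"

(* The block row [C 0] with k zero columns: the two lower blocks have no rows. *)
definition pad_cols :: "real mat \<Rightarrow> nat \<Rightarrow> real mat" where
  "pad_cols C k = four_block_mat C (0\<^sub>m (dim_row C) k) (0\<^sub>m 0 (dim_col C)) (0\<^sub>m 0 k)"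

definition solves_system ::
    "real mat \<Rightarrow> real mat \<Rightarrow> real mat \<Rightarrow> real vec \<Rightarrow> real vec \<Rightarrow> real vec \<Rightarrow> real vec \<Rightarrow> bool" where
  "solves_system K1 K2 L r1 r2 w1 w2 \<longleftrightarrow>
     w1 \<in> carrier_vec (dim_col K1) \<and> w2 \<in> carrier_vec (dim_col K2) \<and>
     four_block_mat K1 L (transpose_mat L) K2 *\<^sub>v (w1 @\<^sub>v w2) = r1 @\<^sub>v r2"

(* The scheme has no initial value for w2: w2 0 is unconstrained and never used. *)
definition block_gauss_seidel ::
    "real mat \<Rightarrow> real mat \<Rightarrow> real mat \<Rightarrow> real vec \<Rightarrow> real vec
      \<Rightarrow> (nat \<Rightarrow> real vec) \<Rightarrow> (nat \<Rightarrow> real vec) \<Rightarrow> bool" where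
  "block_gauss_seidel K1 K2 L r1 r2 w1 w2 \<longleftrightarrow>
     w1 0 \<in> carrier_vec (dim_col K1) \<and>
     (\<forall>j. w2 (Suc j) = mat_inv K2 *\<^sub>v (r2 - transpose_mat L *\<^sub>v w1 j) \<and>
          w1 (Suc j) = mat_inv K1 *\<^sub>v (r1 - L *\<^sub>v w2 (Suc j)))"

(* Convergence in real n-space, taken entrywise since vectors carry no topology here. *)
definition vec_tendsto :: "nat \<Rightarrow> (nat \<Rightarrow> real vec) \<Rightarrow> real vec \<Rightarrow> bool" where
  "vec_tendsto n f l \<longleftrightarrow> (\<forall>i<n. (\<lambda>j. f j $ i) \<longlonglongrightarrow> l $ i)"

definition vec_norm_on :: "nat \<Rightarrow> (real vec \<Rightarrow> real) \<Rightarrow> bool" where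
  "vec_norm_on n N \<longleftrightarrow>
     (\<forall>x \<in> carrier_vec n. N x \<ge> 0 \<and> (N x = 0 \<longleftrightarrow> x = 0\<^sub>v n)) \<and>
     (\<forall>x \<in> carrier_vec n. \<forall>c. N (c \<cdot>\<^sub>v x) = \<bar>c\<bar> * N x) \<and>
     (\<forall>x \<in> carrier_vec n. \<forall>y \<in> carrier_vec n. N (x + y) \<le> N x + N y)"

definition induced_norm :: "nat \<Rightarrow> (real vec \<Rightarrow> real) \<Rightarrow> real mat \<Rightarrow> real" where
  "induced_norm n N A = (SUP x \<in> carrier_vec n - {0\<^sub>v n}. N (A *\<^sub>v x) / N x)"

abbreviation complex_spectrum :: "real mat \<Rightarrow> complex set" where
  "complex_spectrum A \<equiv> spectrum (map_mat complex_of_real A)"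

abbreviation complex_spectral_radius :: "real mat \<Rightarrow> real" where
  "complex_spectral_radius A \<equiv> spectral_radius (map_mat complex_of_real A)"

end

theory Submission
  imports Defs
begin

text \<open>Solving the first block row for $w_1$ and substituting turns the system into the fixed-point
  equation $w_2 = s + \Gamma w_2$, which gives (i); (ii) holds because $\Gamma = XY$ and
  $\widetilde\Gamma = YX$ with $X = K_2^{-1} L^T$, $Y = K_1^{-1} L$. The error of the iteration is
  multiplied by $\widetilde\Gamma$ in each step. For the asymptotics, the sum of the absolute values
  of the entries of $A^j$ is at least $\rho(A)^j$ (apply $A^j$ to an eigenvector) and at most
  $c r^j$ for every $r > \rho(A)$ (the Jordan normal form bounds the powers of $A / r$). Since
  all norms on real n-space are equivalent, any induced norm of $A^j$ obeys the same two bounds up to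
  constant factors, and Gelfand's formula follows by taking $j$-th roots.\<close>

subsection \<open>Powers of a matrix and its spectral radius\<close>

definition l1_norm :: "'a :: real_normed_field vec \<Rightarrow> real" where
  "l1_norm x = (\<Sum>i<dim_vec x. norm (x $ i))"

text \<open>A crude matrix norm that dominates the operator norm induced by \<open>l1_norm\<close>.
  It is polymorphic so that a real matrix and its complexification are measured by the same
  quantity, as \<open>entry_sum_of_real\<close> records.\<close>

definition entry_sum :: "'a :: real_normed_field mat \<Rightarrow> real" where
  "entry_sum A = (\<Sum>i<dim_row A. \<Sum>k<dim_col A. norm (A $$ (i, k)))"

lemma l1_norm_nonneg: "l1_norm x \<ge> 0"
  unfolding l1_norm_def by (simp add: sum_nonneg)

lemma entry_sum_nonneg: "entry_sum A \<ge> 0"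
  unfolding entry_sum_def by (simp add: sum_nonneg)

lemma entry_sum_of_real: "entry_sum (map_mat complex_of_real A) = entry_sum A"
  unfolding entry_sum_def by simp

lemma norm_index_le_l1_norm:
  assumes "i < dim_vec x"
  shows "norm (x $ i) \<le> l1_norm x"
  unfolding l1_norm_def using assms by (intro member_le_sum) auto

lemma l1_norm_eq_0_iff:
  assumes "x \<in> carrier_vec n"
  shows "l1_norm x = 0 \<longleftrightarrow> x = 0\<^sub>v n"
  using assms unfolding l1_norm_def by (subst sum_nonneg_eq_0_iff) (auto simp: vec_eq_iff)

lemma l1_norm_smult: "l1_norm (c \<cdot>\<^sub>v x) = norm c * l1_norm x"
  unfolding l1_norm_def by (simp add: norm_mult sum_distrib_left)

lemma entry_sum_smult: "entry_sum (c \<cdot>\<^sub>m A) = norm c * entry_sum A"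
  unfolding entry_sum_def by (simp add: norm_mult sum_distrib_left)

lemma l1_norm_mult_mat_vec:
  assumes A: "A \<in> carrier_mat nr nc" and x: "x \<in> carrier_vec nc"
  shows "l1_norm (A *\<^sub>v x) \<le> entry_sum A * l1_norm x"
proof -
  have "l1_norm (A *\<^sub>v x) = (\<Sum>i<nr. norm (\<Sum>k<nc. A $$ (i, k) * x $ k))"
    using A x unfolding l1_norm_def
    by (auto simp: scalar_prod_def atLeast0LessThan intro!: sum.cong)
  also have "\<dots> \<le> (\<Sum>i<nr. \<Sum>k<nc. norm (A $$ (i, k)) * l1_norm x)"
  proof (intro sum_mono order.trans[OF norm_sum])
    fix i k assume "k \<in> {..<nc}"
    thus "norm (A $$ (i, k) * x $ k) \<le> norm (A $$ (i, k)) * l1_norm x"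
      using x by (simp add: norm_mult mult_left_mono norm_index_le_l1_norm)
  qed
  also have "\<dots> = entry_sum A * l1_norm x"
    using A unfolding entry_sum_def by (simp add: sum_distrib_right)
  finally show ?thesis .
qed

lemma entry_sum_le_norm_bound:
  assumes "A \<in> carrier_mat n n" and "norm_bound A c"
  shows "entry_sum A \<le> real n * real n * c"
proof -
  have "entry_sum A = (\<Sum>i<n. \<Sum>k<n. norm (A $$ (i, k)))"
    using assms unfolding entry_sum_def by simp
  also have "\<dots> \<le> (\<Sum>i<n. \<Sum>k<n. c)"
    using assms unfolding norm_bound_def by (intro sum_mono) auto
  finally show ?thesis by (simp add: mult.assoc)
qed

lemma pow_smult_mat:
  fixes A :: "'a :: comm_ring_1 mat"
  assumes A: "A \<in> carrier_mat n n"
  shows "(c \<cdot>\<^sub>m A) ^\<^sub>m j = c ^ j \<cdot>\<^sub>m A ^\<^sub>m j"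
proof (induction j)
  case 0
  show ?case using A by (intro eq_matI) auto
next
  case (Suc j)
  have P: "A ^\<^sub>m j \<in> carrier_mat n n" using A by simp
  have "(c \<cdot>\<^sub>m A) ^\<^sub>m Suc j = c ^ j \<cdot>\<^sub>m (A ^\<^sub>m j * (c \<cdot>\<^sub>m A))"
    using Suc mult_smult_assoc_mat[OF P, of "c \<cdot>\<^sub>m A" n "c ^ j"] A by simp
  also have "A ^\<^sub>m j * (c \<cdot>\<^sub>m A) = c \<cdot>\<^sub>m (A ^\<^sub>m j * A)"
    by (rule mult_smult_distrib[OF P A])
  finally show ?case by (auto simp: vec_eq_iff mat_eq_iff)
qed

section \<open>Growth of matrix powers against the spectral radius\<close>

lemma spectral_radius_obtain:
  assumes "A \<in> carrier_mat n n" and "n > 0"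
  obtains k where "eigenvalue A k" and "norm k = spectral_radius A"
  using spectral_radius_mem_max(1)[OF assms] unfolding spectrum_def by auto

lemma norm_eigenvalue_le_spectral_radius:
  assumes "A \<in> carrier_mat n n" and "n > 0" and "eigenvalue A k"
  shows "norm k \<le> spectral_radius A"
  using spectral_radius_mem_max(2)[OF assms(1,2)] assms(3) unfolding spectrum_def by auto

lemma spectral_radius_nonneg:
  assumes "A \<in> carrier_mat n n" and "n > 0"
  shows "spectral_radius A \<ge> 0"
  using spectral_radius_obtain[OF assms] norm_ge_zero by metis

lemma spectral_radius_power_le_entry_sum:
  assumes A: "A \<in> carrier_mat n n" and n: "n > 0"
  shows "spectral_radius A ^ j \<le> entry_sum (A ^\<^sub>m j)"
proof -
  obtain k v where k: "norm k = spectral_radius A" and ev: "eigenvector A v k"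
    using spectral_radius_obtain[OF A n] unfolding eigenvalue_def by metis
  hence v: "v \<in> carrier_vec n" "v \<noteq> 0\<^sub>v n" using A unfolding eigenvector_def by auto
  have "l1_norm v > 0"
    using l1_norm_eq_0_iff[OF v(1)] v(2) l1_norm_nonneg[of v] by linarith
  moreover have "norm (k ^ j) * l1_norm v \<le> entry_sum (A ^\<^sub>m j) * l1_norm v"
    using l1_norm_mult_mat_vec[of "A ^\<^sub>m j" n n v] A v(1) eigenvector_pow[OF A ev, of j]
    by (simp add: l1_norm_smult)
  ultimately show ?thesis by (simp add: norm_power k)
qed

text \<open>The Jordan normal form bounds all powers uniformly once the spectral radius is below 1,
  so the matrix is rescaled by \<open>1 / r\<close>. The gap between the spectral radius and
  \<open>r\<close> absorbs the polynomial growth that Jordan blocks may cause.\<close>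

lemma entry_sum_power_bound:
  assumes A: "A \<in> carrier_mat n n" and n: "n > 0" and r: "spectral_radius A < r"
  shows "\<exists>c. \<forall>j. entry_sum (A ^\<^sub>m j) \<le> c * r ^ j"
proof -
  have r0: "r > 0" using spectral_radius_nonneg[OF A n] r by simp
  define B where "B = complex_of_real (1 / r) \<cdot>\<^sub>m A"
  have B: "B \<in> carrier_mat n n" using A by (simp add: B_def)
  have AB: "A = complex_of_real r \<cdot>\<^sub>m B"
    using r0 by (intro eq_matI) (auto simp: B_def)
  \<comment> \<open>An eigenvalue \<open>k\<close> of \<open>B\<close> gives the eigenvalue
    \<open>r * k\<close> of \<open>A\<close> with the same eigenvector, and its modulus is less than
    \<open>r\<close>.\<close>
  have "spectral_radius B < 1"
  proof -
    obtain k v where k: "norm k = spectral_radius B" and ev: "eigenvector B v k"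
      using spectral_radius_obtain[OF B n] unfolding eigenvalue_def by metis
    hence v: "v \<in> carrier_vec n" "v \<noteq> 0\<^sub>v n" and Bv: "B *\<^sub>v v = k \<cdot>\<^sub>v v"
      using B unfolding eigenvector_def by auto
    have "A *\<^sub>v v = complex_of_real r \<cdot>\<^sub>v (B *\<^sub>v v)"
      unfolding AB using B v by (intro eq_vecI) auto
    hence "eigenvector A v (complex_of_real r * k)"
      using A v Bv unfolding eigenvector_def by (auto simp: smult_smult_assoc)
    hence "norm (complex_of_real r * k) < r"
      using norm_eigenvalue_le_spectral_radius[OF A n] r unfolding eigenvalue_def
      by (meson order.strict_trans1)
    thus ?thesis using r0 k by (simp add: norm_mult)
  qed
  then obtain c where c: "\<And>j. norm_bound (B ^\<^sub>m j) c"
    using spectral_radius_jnf_norm_bound_less_1_upper_triangular[OF B] by auto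
  have "entry_sum (A ^\<^sub>m j) \<le> real n * real n * c * r ^ j" for j
  proof -
    have "entry_sum (A ^\<^sub>m j) = r ^ j * entry_sum (B ^\<^sub>m j)"
      using r0 pow_smult_mat[OF B, of "complex_of_real r" j, folded AB]
      by (simp add: entry_sum_smult norm_power)
    also have "\<dots> \<le> r ^ j * (real n * real n * c)"
      using r0 B by (intro mult_left_mono entry_sum_le_norm_bound c) auto
    finally show ?thesis by (simp add: mult.commute)
  qed
  thus ?thesis by blast
qed

text \<open>Transfer to real matrices: the embedding into the complex numbers commutes with powers
  and preserves \<open>entry_sum\<close>.\<close>

lemma real_spectral_radius_power_le_entry_sum:
  assumes "A \<in> carrier_mat n n" and "n > 0"
  shows "complex_spectral_radius A ^ j \<le> entry_sum (A ^\<^sub>m j)"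
  using spectral_radius_power_le_entry_sum[of "map_mat complex_of_real A" n j] assms
  by (simp add: entry_sum_of_real flip: of_real_hom.mat_hom_pow)

lemma real_entry_sum_power_bound:
  assumes "A \<in> carrier_mat n n" and "n > 0" and "complex_spectral_radius A < r"
  shows "\<exists>c. \<forall>j. entry_sum (A ^\<^sub>m j) \<le> c * r ^ j"
  using entry_sum_power_bound[of "map_mat complex_of_real A" n r] assms
  by (simp add: entry_sum_of_real flip: of_real_hom.mat_hom_pow)

text \<open>If \<open>v\<close> is an eigenvector of \<open>X * Y\<close> for
  \<open>k \<noteq> 0\<close>, then \<open>Y *\<^sub>v v\<close> is one of \<open>Y * X\<close> for
  the same \<open>k\<close>: it cannot vanish, since otherwise \<open>k \<cdot>\<^sub>v v\<close>
  would. For \<open>k = 0\<close> the inequality only says that a spectral radius is nonnegative.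
  Equality follows later by exchanging \<open>X\<close> and \<open>Y\<close>.\<close>

lemma spectral_radius_mult_commute_le:
  assumes X: "X \<in> carrier_mat n m" and Y: "Y \<in> carrier_mat m n" and n: "n > 0" and m: "m > 0"
  shows "spectral_radius (X * Y) \<le> spectral_radius (Y * X)"
proof -
  have XY: "X * Y \<in> carrier_mat n n" and YX: "Y * X \<in> carrier_mat m m" using X Y by auto
  obtain k v where k: "norm k = spectral_radius (X * Y)" and ev: "eigenvector (X * Y) v k"
    using spectral_radius_obtain[OF XY n] unfolding eigenvalue_def by metis
  hence v: "v \<in> carrier_vec n" "v \<noteq> 0\<^sub>v n" and kv: "X *\<^sub>v (Y *\<^sub>v v) = k \<cdot>\<^sub>v v"
    using X Y unfolding eigenvector_def by auto
  show ?thesis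
  proof (cases "k = 0")
    case True
    thus ?thesis using k spectral_radius_nonneg[OF YX m] by simp
  next
    case False
    have "Y *\<^sub>v v \<noteq> 0\<^sub>v m"
    proof
      assume "Y *\<^sub>v v = 0\<^sub>v m"
      moreover have "X *\<^sub>v 0\<^sub>v m = 0\<^sub>v n" using X by (intro eq_vecI) auto
      ultimately have "k \<cdot>\<^sub>v v = 0\<^sub>v n" using kv by simp
      hence "(1 / k) \<cdot>\<^sub>v (k \<cdot>\<^sub>v v) = 0\<^sub>v n" by (auto intro!: eq_vecI)
      thus False using False v by (simp add: smult_smult_assoc)
    qed
    hence "eigenvector (Y * X) (Y *\<^sub>v v) k"
      using X Y v(1) kv unfolding eigenvector_def
      by (auto simp: mult_mat_vec)
    thus ?thesis
      using norm_eigenvalue_le_spectral_radius[OF YX m] k unfolding eigenvalue_def by metis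
  qed
qed

lemma complex_spectral_radius_mult_commute:
  assumes X: "X \<in> carrier_mat n m" and Y: "Y \<in> carrier_mat m n" and n: "n > 0" and m: "m > 0"
  shows "complex_spectral_radius (X * Y) = complex_spectral_radius (Y * X)"
  using spectral_radius_mult_commute_le[of "map_mat complex_of_real X" n m "map_mat complex_of_real Y"]
    spectral_radius_mult_commute_le[of "map_mat complex_of_real Y" m n "map_mat complex_of_real X"] assms
  by (simp add: of_real_hom.mat_hom_mult[OF X Y] of_real_hom.mat_hom_mult[OF Y X])

section \<open>Matrix powers that tend to zero\<close>

lemma vec_tendsto_0_if_spectral_radius_less_1:
  assumes A: "A \<in> carrier_mat n n" and n: "n > 0" and x: "x \<in> carrier_vec n"
    and rho: "complex_spectral_radius A < 1"
  shows "vec_tendsto n (\<lambda>j. A ^\<^sub>m j *\<^sub>v x) (0\<^sub>v n)"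
proof -
  \<comment> \<open>Room on both sides of \<open>r\<close> is needed: above the spectral radius for
    the power bound, below 1 for a null geometric sequence.\<close>
  obtain r where r: "complex_spectral_radius A < r" "r < 1" using dense rho by blast
  have r0: "r > 0" using r spectral_radius_nonneg[of "map_mat complex_of_real A" n] A n by simp
  obtain c where c: "\<And>j. entry_sum (A ^\<^sub>m j) \<le> c * r ^ j"
    using real_entry_sum_power_bound[OF A n r(1)] by blast
  have lim: "(\<lambda>j. c * r ^ j * l1_norm x) \<longlonglongrightarrow> 0"
    using r r0 by (auto intro!: tendsto_eq_intros LIMSEQ_power_zero)
  have "(\<lambda>j. (A ^\<^sub>m j *\<^sub>v x) $ i) \<longlonglongrightarrow> 0" if i: "i < n" for i
  proof (rule tendsto_0_le[OF lim always_eventually, of _ 1], intro allI)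
    fix j
    have "norm ((A ^\<^sub>m j *\<^sub>v x) $ i) \<le> l1_norm (A ^\<^sub>m j *\<^sub>v x)"
      using A i by (intro norm_index_le_l1_norm) simp
    also have "\<dots> \<le> entry_sum (A ^\<^sub>m j) * l1_norm x"
      using A x by (intro l1_norm_mult_mat_vec) auto
    also have "\<dots> \<le> c * r ^ j * l1_norm x"
      by (intro mult_right_mono c l1_norm_nonneg)
    finally show "norm ((A ^\<^sub>m j *\<^sub>v x) $ i) \<le> norm (c * r ^ j * l1_norm x) * 1"
      by simp
  qed
  thus ?thesis unfolding vec_tendsto_def by simp
qed

text \<open>A spectral radius of at least 1 keeps \<open>entry_sum\<close> of every power at or
  above 1. But unit vectors as \<open>x\<close> pick out the columns of the powers, so every entry,
  and hence the finite sum of their absolute values, tends to 0.\<close>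

lemma spectral_radius_less_1_if_vec_tendsto_0:
  assumes A: "A \<in> carrier_mat n n" and n: "n > 0"
    and lim: "\<And>x. x \<in> carrier_vec n \<Longrightarrow> vec_tendsto n (\<lambda>j. A ^\<^sub>m j *\<^sub>v x) (0\<^sub>v n)"
  shows "complex_spectral_radius A < 1"
proof (rule ccontr)
  assume "\<not> complex_spectral_radius A < 1"
  hence one: "1 \<le> entry_sum (A ^\<^sub>m j)" for j
    using real_spectral_radius_power_le_entry_sum[OF A n, of j]
      one_le_power[of "complex_spectral_radius A" j] by linarith
  have "(\<lambda>j. (A ^\<^sub>m j) $$ (i, k)) \<longlonglongrightarrow> 0" if "i < n" "k < n" for i k
    using lim[of "unit_vec n k"] A that unfolding vec_tendsto_def by simp
  hence "(\<lambda>j. \<Sum>i<n. \<Sum>k<n. norm ((A ^\<^sub>m j) $$ (i, k))) \<longlonglongrightarrow> 0"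
    by (intro tendsto_null_sum tendsto_norm_zero) auto
  hence "(\<lambda>j. entry_sum (A ^\<^sub>m j)) \<longlonglongrightarrow> 0"
    using A pow_carrier_mat[OF A] unfolding entry_sum_def by (simp del: pow_mat_dim)
  from LIMSEQ_le_const[OF this, of 1] one show False by auto
qed

subsection \<open>Norms on real n-space and induced matrix norms\<close>

lemma vec_norm_onD:
  assumes "vec_norm_on n N" and "x \<in> carrier_vec n"
  shows "N x \<ge> 0" and "N x = 0 \<longleftrightarrow> x = 0\<^sub>v n" and "N (c \<cdot>\<^sub>v x) = \<bar>c\<bar> * N x"
    and "y \<in> carrier_vec n \<Longrightarrow> N (x + y) \<le> N x + N y"
  using assms unfolding vec_norm_on_def by blast+

text \<open>The triangle inequality for the expansion in unit vectors. The induction runs over the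
  number \<open>k\<close> of leading coordinates that may be nonzero, so the dimension
  \<open>n\<close>, and with it the norm, stays fixed.\<close>

lemma vec_norm_le_sum_unit:
  assumes N: "vec_norm_on n N" and "k \<le> n" and "x \<in> carrier_vec n"
    and "\<And>i. k \<le> i \<Longrightarrow> i < n \<Longrightarrow> x $ i = 0"
  shows "N x \<le> (\<Sum>i<k. \<bar>x $ i\<bar> * N (unit_vec n i))"
  using assms(2-)
proof (induction k arbitrary: x)
  case 0
  hence "x = 0\<^sub>v n" by (intro eq_vecI) auto
  thus ?case using vec_norm_onD(2)[OF N, of x] by simp
next
  case (Suc k)
  define y where "y = vec n (\<lambda>i. if i < k then x $ i else 0)"
  have y: "y \<in> carrier_vec n" by (simp add: y_def)
  have "x = y + x $ k \<cdot>\<^sub>v unit_vec n k"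
    using Suc.prems by (intro eq_vecI) (auto simp: y_def not_less_eq less_antisym)
  hence "N x \<le> N y + N (x $ k \<cdot>\<^sub>v unit_vec n k)"
    using vec_norm_onD(4)[OF N y, of "x $ k \<cdot>\<^sub>v unit_vec n k"] by simp
  also have "N (x $ k \<cdot>\<^sub>v unit_vec n k) = \<bar>x $ k\<bar> * N (unit_vec n k)"
    by (intro vec_norm_onD(3)[OF N]) simp
  also have "N y \<le> (\<Sum>i<k. \<bar>y $ i\<bar> * N (unit_vec n i))"
    using Suc.prems y by (intro Suc.IH) (auto simp: y_def)
  also have "\<dots> = (\<Sum>i<k. \<bar>x $ i\<bar> * N (unit_vec n i))"
    using Suc.prems by (intro sum.cong) (auto simp: y_def)
  finally show ?case by simp
qed

lemma vec_norm_le_l1_norm: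
  assumes N: "vec_norm_on n N"
  obtains c where "c > 0" and "\<And>x. x \<in> carrier_vec n \<Longrightarrow> N x \<le> c * l1_norm x"
proof
  define s where "s = (\<Sum>i<n. N (unit_vec n i))"
  have Nu: "N (unit_vec n i) \<ge> 0" for i using vec_norm_onD(1)[OF N] by simp
  \<comment> \<open>The summand 1 keeps the constant positive when \<open>n = 0\<close>, where
    \<open>s\<close> is an empty sum.\<close>
  show "1 + s > 0" unfolding s_def using sum_nonneg[of "{..<n}" "\<lambda>i. N (unit_vec n i)"] Nu by simp
  fix x :: "real vec" assume x: "x \<in> carrier_vec n"
  have "N x \<le> (\<Sum>i<n. \<bar>x $ i\<bar> * N (unit_vec n i))"
    by (rule vec_norm_le_sum_unit[OF N order.refl x]) simp
  also have "\<dots> \<le> (\<Sum>i<n. l1_norm x * N (unit_vec n i))"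
    using x norm_index_le_l1_norm[of _ x] by (intro sum_mono mult_right_mono Nu) auto
  also have "\<dots> \<le> (1 + s) * l1_norm x"
    using l1_norm_nonneg[of x] by (simp add: s_def sum_distrib_left algebra_simps)
  finally show "N x \<le> (1 + s) * l1_norm x" .
qed

text \<open>Bolzano-Weierstrass by successive extraction: a monotone subsequence of the new
  coordinate converges because it is bounded, and the coordinates treated before still converge
  along it.\<close>

lemma coordinatewise_convergent_subseq:
  fixes f :: "nat \<Rightarrow> nat \<Rightarrow> real"
  assumes "\<And>i. i < n \<Longrightarrow> Bseq (f i)"
  shows "\<exists>r. strict_mono r \<and> (\<forall>i<n. convergent (\<lambda>k. f i (r k)))"
  using assms
proof (induction n)
  case 0
  have "strict_mono (id :: nat \<Rightarrow> nat)" by (simp add: strict_mono_def)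
  thus ?case by blast
next
  case (Suc n)
  then obtain r where r: "strict_mono r" "\<And>i. i < n \<Longrightarrow> convergent (\<lambda>k. f i (r k))"
    by fastforce
  obtain s where s: "strict_mono s" "monoseq (\<lambda>k. f n (r (s k)))"
    using seq_monosub[of "\<lambda>k. f n (r k)"] by auto
  have "Bseq (f n)" by (simp add: Suc.prems)
  hence "Bseq (\<lambda>k. f n (r (s k)))" unfolding Bseq_def by blast
  hence "convergent (\<lambda>k. f n (r (s k)))" using s(2) by (rule Bseq_monoseq_convergent)
  moreover have "convergent (\<lambda>k. f i (r (s k)))" if "i < n" for i
    using convergent_subseq_convergent[OF r(2)[OF that] s(1)] by (simp add: o_def)
  ultimately have "\<forall>i<Suc n. convergent (\<lambda>k. f i ((r \<circ> s) k))"
    by (auto simp: less_Suc_eq)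
  thus ?case using strict_mono_o[OF r(1) s(1)] by blast
qed

lemma vec_tendsto_imp_l1_norm_diff:
  assumes "vec_tendsto n f l" and "\<And>k. f k \<in> carrier_vec n" and "l \<in> carrier_vec n"
  shows "(\<lambda>k. l1_norm (l - f k)) \<longlonglongrightarrow> 0"
proof -
  have "(\<lambda>k. \<Sum>i<n. norm (l $ i - f k $ i)) \<longlonglongrightarrow> (\<Sum>i<n. norm (l $ i - l $ i))"
    using assms(1) unfolding vec_tendsto_def by (intro tendsto_intros) auto
  moreover have "l1_norm (l - f k) = (\<Sum>i<n. norm (l $ i - f k $ i))" for k
    using assms(2)[of k] assms(3) unfolding l1_norm_def by (auto intro!: sum.cong)
  ultimately show ?thesis by simp
qed

text \<open>Compactness of the unit sphere of the l1 norm: a sequence on it along which the norm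
  tends to 0 would have an accumulation point of norm 0 on the sphere.\<close>

lemma l1_norm_le_vec_norm:
  assumes N: "vec_norm_on n N"
  obtains c where "c > 0" and "\<And>x. x \<in> carrier_vec n \<Longrightarrow> l1_norm x \<le> c * N x"
proof (rule ccontr)
  assume "\<not> thesis"
  \<comment> \<open>The candidate constants are \<open>Suc k\<close>, which are positive and
    unbounded; each of them fails at some vector.\<close>
  hence "\<exists>x \<in> carrier_vec n. l1_norm x > real (Suc k) * N x" for k
    using that[of "real (Suc k)"] by (meson not_le of_nat_0_less_iff zero_less_Suc)
  then obtain x where x: "\<And>k. x k \<in> carrier_vec n"
    and big: "\<And>k. l1_norm (x k) > real (Suc k) * N (x k)"
    by metis
  define y where "y k = (1 / l1_norm (x k)) \<cdot>\<^sub>v x k" for k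
  \<comment> \<open>Strictness of \<open>big\<close> together with \<open>N (x k) \<ge> 0\<close>
    excludes the zero vector, so \<open>x k\<close> can be normalised.\<close>
  have pos: "l1_norm (x k) > 0" for k
    using big[of k] vec_norm_onD(1)[OF N x[of k]]
    by (smt (verit) mult_nonneg_nonneg of_nat_0_le_iff)
  have y: "y k \<in> carrier_vec n" and y1: "l1_norm (y k) = 1" for k
    using x pos[of k] by (simp_all add: y_def l1_norm_smult)
  have Ny: "N (y k) \<le> 1 / real (Suc k)" for k
    using big[of k] pos[of k]
    by (simp add: y_def vec_norm_onD(3)[OF N x] divide_simps mult.commute)
  have "Bseq (\<lambda>k. y k $ i)" if "i < n" for i
  proof (rule BseqI')
    fix k
    show "norm (y k $ i) \<le> 1"
      using norm_index_le_l1_norm[of i "y k"] y[of k] y1[of k] that by simp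
  qed
  then obtain r where r: "strict_mono r" "\<forall>i<n. convergent (\<lambda>k. y (r k) $ i)"
    using coordinatewise_convergent_subseq[of n "\<lambda>i k. y k $ i"] by auto
  define l where "l = vec n (\<lambda>i. lim (\<lambda>k. y (r k) $ i))"
  have l: "l \<in> carrier_vec n" by (simp add: l_def)
  have "vec_tendsto n (\<lambda>k. y (r k)) l"
    using r(2) unfolding vec_tendsto_def l_def by (simp add: convergent_LIMSEQ_iff)
  hence lim: "(\<lambda>k. l1_norm (l - y (r k))) \<longlonglongrightarrow> 0"
    using vec_tendsto_imp_l1_norm_diff[of n "\<lambda>k. y (r k)" l] y l by simp
  have split: "l = (l - y (r k)) + y (r k)" for k
    using y[of "r k"] l by (intro eq_vecI) auto
  obtain c where c: "c > 0" "\<And>x. x \<in> carrier_vec n \<Longrightarrow> N x \<le> c * l1_norm x"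
    using vec_norm_le_l1_norm[OF N] by blast
  \<comment> \<open>Here the upper comparison of \<open>N\<close> with the l1 norm acts as
    continuity of \<open>N\<close>; the second term is small by the choice of \<open>y\<close>,
    since \<open>r k \<ge> k\<close>.\<close>
  have Nl_le: "N l \<le> c * l1_norm (l - y (r k)) + 1 / real (Suc k)" for k
  proof -
    have "N l \<le> N (l - y (r k)) + N (y (r k))"
      using vec_norm_onD(4)[OF N, of "l - y (r k)" "y (r k)"] y l split by simp
    also have "N (l - y (r k)) \<le> c * l1_norm (l - y (r k))"
      using y l by (intro c(2)) simp
    also have "N (y (r k)) \<le> 1 / real (Suc (r k))" by (rule Ny)
    also have "\<dots> \<le> 1 / real (Suc k)"
      using seq_suble[OF r(1), of k] by (intro frac_le) auto
    finally show ?thesis by simp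
  qed
  have "(\<lambda>k. c * l1_norm (l - y (r k)) + 1 / real (Suc k)) \<longlonglongrightarrow> c * 0 + 0"
    by (intro tendsto_intros lim LIMSEQ_Suc lim_1_over_n)
  from LIMSEQ_le_const[OF this] Nl_le have "N l \<le> 0" by simp
  \<comment> \<open>With \<open>l = 0\<close> the l1 distance from \<open>l\<close> to each
    \<open>y (r k)\<close> is constantly 1, whereas \<open>lim\<close> says that it tends to
    0.\<close>
  hence "l = 0\<^sub>v n" using vec_norm_onD(1,2)[OF N l] by simp
  moreover have "l1_norm (0\<^sub>v n - y k) = 1" for k
    using y1[of k] y[of k] unfolding l1_norm_def by simp
  ultimately show False using lim LIMSEQ_unique[of "\<lambda>_. 1 :: real" 1 0] by simp
qed

section \<open>The induced matrix norm\<close>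

lemma vec_norm_pos:
  assumes "vec_norm_on n N" and "x \<in> carrier_vec n - {0\<^sub>v n}"
  shows "N x > 0"
  using vec_norm_onD(1,2)[OF assms(1), of x] assms(2) by auto

text \<open>Passing to the l1 norm and back costs two constants that depend on \<open>N\<close>
  alone. The bound makes the quotients in \<open>induced_norm\<close> bounded above, and its
  constant serves all powers of a matrix at once.\<close>

lemma vec_norm_mult_mat_vec_le_entry_sum:
  assumes N: "vec_norm_on n N"
  obtains c where "c > 0"
    and "\<And>A x. A \<in> carrier_mat n n \<Longrightarrow> x \<in> carrier_vec n \<Longrightarrow> N (A *\<^sub>v x) \<le> c * entry_sum A * N x"
proof -
  obtain c1 where c1: "c1 > 0" "\<And>x. x \<in> carrier_vec n \<Longrightarrow> N x \<le> c1 * l1_norm x"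
    using vec_norm_le_l1_norm[OF N] by blast
  obtain c2 where c2: "c2 > 0" "\<And>x. x \<in> carrier_vec n \<Longrightarrow> l1_norm x \<le> c2 * N x"
    using l1_norm_le_vec_norm[OF N] by blast
  show thesis
  proof
    show "c1 * c2 > 0" using c1 c2 by simp
    fix A :: "real mat" and x :: "real vec" assume A: "A \<in> carrier_mat n n" and x: "x \<in> carrier_vec n"
    have "N (A *\<^sub>v x) \<le> c1 * l1_norm (A *\<^sub>v x)" using A x by (intro c1) simp
    also have "\<dots> \<le> c1 * (entry_sum A * l1_norm x)"
      using c1 l1_norm_mult_mat_vec[OF A x] by simp
    also have "\<dots> \<le> c1 * (entry_sum A * (c2 * N x))"
      using c1 c2(2)[OF x] by (intro mult_left_mono entry_sum_nonneg) auto
    finally show "N (A *\<^sub>v x) \<le> c1 * c2 * entry_sum A * N x" by (simp add: mult_ac)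
  qed
qed

lemma induced_norm_le:
  assumes N: "vec_norm_on n N" and n: "n > 0"
    and le: "\<And>x. x \<in> carrier_vec n \<Longrightarrow> N (A *\<^sub>v x) \<le> c * N x"
  shows "induced_norm n N A \<le> c"
  unfolding induced_norm_def
proof (rule cSUP_least)
  \<comment> \<open>A nonzero vector exists because \<open>n > 0\<close>; a supremum over the empty
    set would carry no information.\<close>
  have "unit_vec n 0 \<noteq> (0\<^sub>v n :: real vec)" using n by (auto simp: vec_eq_iff)
  thus "carrier_vec n - {0\<^sub>v n} \<noteq> ({} :: real vec set)" by (auto intro: unit_vec_carrier)
next
  fix x :: "real vec" assume x: "x \<in> carrier_vec n - {0\<^sub>v n}"
  thus "N (A *\<^sub>v x) / N x \<le> c"
    using vec_norm_pos[OF N x] le[of x] by (simp add: divide_simps)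
qed

text \<open>The reals are only conditionally complete, so a quotient lies below its supremum only
  after boundedness has been shown. The zero vector is not among the quotients and is treated on its
  own.\<close>

lemma vec_norm_mult_mat_vec_le_induced_norm:
  assumes N: "vec_norm_on n N" and A: "A \<in> carrier_mat n n" and x: "x \<in> carrier_vec n"
  shows "N (A *\<^sub>v x) \<le> induced_norm n N A * N x"
proof (cases "x = 0\<^sub>v n")
  case True
  hence "A *\<^sub>v x = 0\<^sub>v n" using A by (intro eq_vecI) auto
  thus ?thesis using True vec_norm_onD(2)[OF N x] by simp
next
  case False
  obtain c where c: "\<And>x. x \<in> carrier_vec n \<Longrightarrow> N (A *\<^sub>v x) \<le> c * N x"
    using vec_norm_mult_mat_vec_le_entry_sum[OF N] A by metis
  have "N (A *\<^sub>v x) / N x \<le> induced_norm n N A"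
    unfolding induced_norm_def
  proof (rule cSUP_upper)
    show "bdd_above ((\<lambda>x. N (A *\<^sub>v x) / N x) ` (carrier_vec n - {0\<^sub>v n}))"
    proof (rule bdd_aboveI2)
      fix x :: "real vec" assume x: "x \<in> carrier_vec n - {0\<^sub>v n}"
      show "N (A *\<^sub>v x) / N x \<le> c"
        using vec_norm_pos[OF N x] c[of x] x by (simp add: divide_simps)
    qed
  qed (use x False in auto)
  moreover have "N x > 0" using vec_norm_pos[OF N, of x] x False by simp
  ultimately show ?thesis by (simp add: divide_simps)
qed

lemma induced_norm_le_entry_sum:
  assumes N: "vec_norm_on n N" and n: "n > 0"
  obtains c where "c > 0" and "\<And>A. A \<in> carrier_mat n n \<Longrightarrow> induced_norm n N A \<le> c * entry_sum A"
  using vec_norm_mult_mat_vec_le_entry_sum[OF N] induced_norm_le[OF N n] by metis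

lemma induced_norm_nonneg:
  assumes N: "vec_norm_on n N" and n: "n > 0" and A: "A \<in> carrier_mat n n"
  shows "induced_norm n N A \<ge> 0"
proof -
  let ?e = "unit_vec n 0 :: real vec"
  have "?e \<noteq> 0\<^sub>v n" using n by (auto simp: vec_eq_iff)
  hence "N ?e > 0" by (intro vec_norm_pos[OF N]) simp
  moreover have "0 \<le> induced_norm n N A * N ?e"
    using vec_norm_mult_mat_vec_le_induced_norm[OF N A, of ?e] vec_norm_onD(1)[OF N, of "A *\<^sub>v ?e"] A
    by simp
  ultimately show ?thesis by (simp add: zero_le_mult_iff)
qed

text \<open>The columns of \<open>A\<close> are its values at the unit vectors, so
  \<open>entry_sum A\<close> is the sum of the l1 norms of these values, each controlled by the
  induced norm.\<close>

lemma entry_sum_le_induced_norm: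
  assumes N: "vec_norm_on n N" and n: "n > 0"
  obtains c where "c > 0" and "\<And>A. A \<in> carrier_mat n n \<Longrightarrow> entry_sum A \<le> c * induced_norm n N A"
proof -
  obtain b where b: "b > 0" "\<And>x. x \<in> carrier_vec n \<Longrightarrow> l1_norm x \<le> b * N x"
    using l1_norm_le_vec_norm[OF N] by blast
  define s where "s = (\<Sum>k<n. N (unit_vec n k))"
  have s: "s \<ge> 0" unfolding s_def by (intro sum_nonneg vec_norm_onD(1)[OF N]) simp
  show thesis
  proof
    \<comment> \<open>Only \<open>s \<ge> 0\<close> has been established; adding 1 yields a positive
      constant.\<close>
    show "b * (s + 1) > 0" using b s by simp
    fix A :: "real mat" assume A: "A \<in> carrier_mat n n"
    have "entry_sum A = (\<Sum>k<n. \<Sum>i<n. norm (A $$ (i, k)))"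
      using A unfolding entry_sum_def by simp (rule sum.swap)
    also have "\<dots> = (\<Sum>k<n. l1_norm (A *\<^sub>v unit_vec n k))"
      using A unfolding l1_norm_def by (auto intro!: sum.cong)
    also have "\<dots> \<le> (\<Sum>k<n. b * (induced_norm n N A * N (unit_vec n k)))"
    proof (rule sum_mono)
      fix k
      have "l1_norm (A *\<^sub>v unit_vec n k) \<le> b * N (A *\<^sub>v unit_vec n k)" using A by (intro b(2)) simp
      also have "\<dots> \<le> b * (induced_norm n N A * N (unit_vec n k))"
        using b(1) vec_norm_mult_mat_vec_le_induced_norm[OF N A, of "unit_vec n k"] by simp
      finally show "l1_norm (A *\<^sub>v unit_vec n k) \<le> b * (induced_norm n N A * N (unit_vec n k))" .
    qed
    also have "\<dots> = b * s * induced_norm n N A"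
      by (simp add: s_def sum_distrib_left sum_distrib_right mult_ac)
    also have "\<dots> \<le> b * (s + 1) * induced_norm n N A"
      using b(1) induced_norm_nonneg[OF N n A] by (intro mult_right_mono) auto
    finally show "entry_sum A \<le> b * (s + 1) * induced_norm n N A" .
  qed
qed

subsection \<open>Gelfand's formula\<close>

text \<open>The scalar core of Gelfand's formula: a positive constant factor has j-th roots tending
  to 1, so the lower bound pushes the roots of \<open>a j\<close> above any
  \<open>l < \<rho>\<close> and the upper bounds push them below any
  \<open>u > \<rho>\<close>.\<close>

lemma root_powr_tendsto:
  fixes a :: "nat \<Rightarrow> real"
  assumes nonneg: "\<And>j. a j \<ge> 0" and rho: "\<rho> \<ge> 0"
    and c: "c > 0" and lower: "\<And>j. \<rho> ^ j \<le> c * a j"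
    and upper: "\<And>r. r > \<rho> \<Longrightarrow> \<exists>C. \<forall>j. a j \<le> C * r ^ j"
  shows "(\<lambda>j. a j powr (1 / real j)) \<longlonglongrightarrow> \<rho>"
proof -
  have lim: "(\<lambda>j. C powr (1 / real j) * r) \<longlonglongrightarrow> r" if "C > 0" for C r :: real
    using tendsto_mult[OF tendsto_powr[OF tendsto_const lim_1_over_n, of C] tendsto_const[of r]] that
    by simp
  \<comment> \<open>The index \<open>j = 0\<close> is excluded because \<open>1 / real 0\<close> is
    0. The case \<open>r = 0\<close> is split off because \<open>powr_realpow\<close> needs a
    positive base.\<close>
  have root: "(C * r ^ j) powr (1 / real j) = C powr (1 / real j) * r"
    if "C > 0" "r \<ge> 0" "j > 0" for C r :: real and j
    using that by (cases "r = 0") (auto simp: powr_mult powr_powr simp flip: powr_realpow)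
  show ?thesis
  proof (rule order_tendstoI)
    fix l assume "l < \<rho>"
    hence "\<forall>\<^sub>F j in sequentially. l < (1 / c) powr (1 / real j) * \<rho>"
      using order_tendstoD(1)[OF lim[of "1 / c" \<rho>]] c by simp
    thus "\<forall>\<^sub>F j in sequentially. l < a j powr (1 / real j)"
      using eventually_gt_at_top[of 0]
    proof eventually_elim
      case (elim j)
      have "(1 / c * \<rho> ^ j) powr (1 / real j) \<le> a j powr (1 / real j)"
        using c rho lower[of j] by (intro powr_mono2) (auto simp: divide_simps mult.commute)
      thus ?case using elim c rho root[of "1 / c" \<rho> j] by simp
    qed
  next
    fix u assume "\<rho> < u"
    then obtain r where r: "\<rho> < r" "r < u" using dense by blast
    obtain C where C: "\<And>j. a j \<le> C * r ^ j" using upper[OF r(1)] by blast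
    \<comment> \<open>\<open>C\<close> is not known to be positive, while the limit of its roots
      requires that; \<open>max C 1\<close> is a positive replacement.\<close>
    have "\<forall>\<^sub>F j in sequentially. max C 1 powr (1 / real j) * r < u"
      using order_tendstoD(2)[OF lim[of "max C 1" r] r(2)] by simp
    thus "\<forall>\<^sub>F j in sequentially. a j powr (1 / real j) < u"
      using eventually_gt_at_top[of 0]
    proof eventually_elim
      case (elim j)
      have "a j \<le> max C 1 * r ^ j"
        using C[of j] rho r by (meson max.cobounded1 mult_right_mono order.trans zero_le_power less_imp_le)
      hence "a j powr (1 / real j) \<le> (max C 1 * r ^ j) powr (1 / real j)"
        using nonneg by (intro powr_mono2) auto
      thus ?case using elim rho r root[of "max C 1" r j] by simp
    qed
  qed
qed

text \<open>The constants \<open>c\<close> and \<open>d\<close> comparing the induced norm with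
  \<open>entry_sum\<close> are independent of the matrix, so both growth bounds carry over to all
  powers simultaneously.\<close>

lemma gelfand_formula:
  assumes A: "A \<in> carrier_mat n n" and n: "n > 0" and N: "vec_norm_on n N"
  shows "(\<lambda>j. induced_norm n N (A ^\<^sub>m j) powr (1 / real j)) \<longlonglongrightarrow> complex_spectral_radius A"
proof -
  have P: "A ^\<^sub>m j \<in> carrier_mat n n" for j using A by simp
  obtain c where c: "c > 0" "\<And>B. B \<in> carrier_mat n n \<Longrightarrow> entry_sum B \<le> c * induced_norm n N B"
    using entry_sum_le_induced_norm[OF N n] by blast
  obtain d where d: "d > 0" "\<And>B. B \<in> carrier_mat n n \<Longrightarrow> induced_norm n N B \<le> d * entry_sum B"
    using induced_norm_le_entry_sum[OF N n] by blast
  show ?thesis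
  proof (rule root_powr_tendsto[OF _ _ c(1)])
    show "complex_spectral_radius A \<ge> 0"
      using A n by (intro spectral_radius_nonneg) auto
  next
    fix j
    show "complex_spectral_radius A ^ j \<le> c * induced_norm n N (A ^\<^sub>m j)"
      using real_spectral_radius_power_le_entry_sum[OF A n, of j] c(2)[OF P] by (rule order.trans)
  next
    fix r assume "r > complex_spectral_radius A"
    then obtain C where C: "\<And>j. entry_sum (A ^\<^sub>m j) \<le> C * r ^ j"
      using real_entry_sum_power_bound[OF A n] by blast
    have "induced_norm n N (A ^\<^sub>m j) \<le> d * C * r ^ j" for j
      using d(2)[OF P, of j] order.trans[OF _ mult_left_mono[OF C[of j], of d]] d(1)
      by (simp add: mult.assoc)
    thus "\<exists>C. \<forall>j. induced_norm n N (A ^\<^sub>m j) \<le> C * r ^ j" by blast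
  qed (rule induced_norm_nonneg[OF N n P])
qed

subsection \<open>Fixed points and the block system\<close>

text \<open>The characteristic polynomial commutes with the embedding into the complex numbers, and
  1 is real. So 1 is a root over one field iff it is over the other, and a real eigenvector
  exists.\<close>

lemma one_in_complex_spectrum_iff:
  assumes A: "A \<in> carrier_mat n n"
  shows "1 \<in> complex_spectrum A \<longleftrightarrow> (\<exists>v. v \<in> carrier_vec n \<and> v \<noteq> 0\<^sub>v n \<and> A *\<^sub>v v = v)"
proof -
  have cA: "map_mat complex_of_real A \<in> carrier_mat n n" using A by simp
  have "1 \<in> complex_spectrum A \<longleftrightarrow> poly (char_poly (map_mat complex_of_real A)) (of_real 1) = 0"
    using eigenvalue_root_char_poly[OF cA, of 1] unfolding spectrum_def by simp
  also have "\<dots> \<longleftrightarrow> poly (char_poly A) 1 = 0"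
    unfolding of_real_hom.char_poly_hom[OF A] of_real_hom.poly_map_poly by simp
  also have "\<dots> \<longleftrightarrow> eigenvalue A 1"
    by (rule eigenvalue_root_char_poly[OF A, symmetric])
  finally show ?thesis
    using A unfolding eigenvalue_def eigenvector_def by auto
qed

lemma one_minus_mult_mat_vec_eq_iff:
  fixes A :: "real mat"
  assumes A: "A \<in> carrier_mat n n" and x: "x \<in> carrier_vec n" and s: "s \<in> carrier_vec n"
  shows "(1\<^sub>m n - A) *\<^sub>v x = s \<longleftrightarrow> x = s + A *\<^sub>v x"
proof -
  have "(1\<^sub>m n - A) *\<^sub>v x = x - A *\<^sub>v x"
    using A x by (subst minus_mult_distrib_mat_vec[of _ n n]) auto
  thus ?thesis using A x s by (auto simp: vec_eq_iff algebra_simps simp del: index_mult_mat_vec)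
qed

text \<open>Adding an eigenvector for 1 to a fixed point yields a second fixed point. Conversely,
  without such an eigenvector \<open>1\<^sub>m n - A\<close> has nonzero determinant, and its
  inverse applied to \<open>s\<close> is the only fixed point.\<close>

lemma ex1_fixed_point_iff:
  assumes A: "A \<in> carrier_mat n n" and s: "s \<in> carrier_vec n"
  shows "(\<exists>!x. x \<in> carrier_vec n \<and> x = s + A *\<^sub>v x) \<longleftrightarrow> 1 \<notin> complex_spectrum A"
proof
  assume ex1: "\<exists>!x. x \<in> carrier_vec n \<and> x = s + A *\<^sub>v x"
  then obtain x where x: "x \<in> carrier_vec n" "x = s + A *\<^sub>v x"
    and uniq: "\<And>y. y \<in> carrier_vec n \<Longrightarrow> y = s + A *\<^sub>v y \<Longrightarrow> y = x" by blast
  show "1 \<notin> complex_spectrum A"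
  proof
    assume "1 \<in> complex_spectrum A"
    then obtain v where v: "v \<in> carrier_vec n" "v \<noteq> 0\<^sub>v n" "A *\<^sub>v v = v"
      unfolding one_in_complex_spectrum_iff[OF A] by blast
    have "s + A *\<^sub>v (x + v) = (s + A *\<^sub>v x) + v"
      using A s x(1) v by (simp add: mult_add_distrib_mat_vec[of _ n n] assoc_add_vec[of _ n])
    also have "s + A *\<^sub>v x = x" by (rule x(2)[symmetric])
    finally have "x + v = x" using x(1) v(1) by (intro uniq[OF _ sym]) auto
    thus False using x(1) v(1,2) by (auto simp: vec_eq_iff)
  qed
next
  assume not1: "1 \<notin> complex_spectrum A"
  define M where "M = 1\<^sub>m n - A"
  have M: "M \<in> carrier_mat n n" unfolding M_def using A by (rule minus_carrier_mat)
  have M_eq: "M *\<^sub>v x = t \<longleftrightarrow> x = t + A *\<^sub>v x" if "x \<in> carrier_vec n" "t \<in> carrier_vec n" for x t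
    unfolding M_def by (rule one_minus_mult_mat_vec_eq_iff[OF A that])
  have "det M \<noteq> 0"
  proof
    assume "det M = 0"
    then obtain v where v: "v \<in> carrier_vec n" "v \<noteq> 0\<^sub>v n" "M *\<^sub>v v = 0\<^sub>v n"
      unfolding det_0_iff_vec_prod_zero[OF M] by blast
    hence "A *\<^sub>v v = v" using M_eq[of v "0\<^sub>v n"] A by simp
    thus False using v not1 one_in_complex_spectrum_iff[OF A] by blast
  qed
  then obtain B where B: "B \<in> carrier_mat n n" "B * M = 1\<^sub>m n" "M * B = 1\<^sub>m n"
    using det_non_zero_imp_unit[OF M, of "()"] unfolding Units_def ring_mat_def by auto
  show "\<exists>!x. x \<in> carrier_vec n \<and> x = s + A *\<^sub>v x"
  proof (rule ex1I[of _ "B *\<^sub>v s"])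
    have "M *\<^sub>v (B *\<^sub>v s) = s"
      using B M s by (simp flip: assoc_mult_mat_vec[of M n n B n])
    thus "B *\<^sub>v s \<in> carrier_vec n \<and> B *\<^sub>v s = s + A *\<^sub>v (B *\<^sub>v s)"
      using M_eq[of "B *\<^sub>v s" s] B s by simp
  next
    fix x assume x: "x \<in> carrier_vec n \<and> x = s + A *\<^sub>v x"
    hence "M *\<^sub>v x = s" using M_eq[of x s] s by blast
    hence "B *\<^sub>v (M *\<^sub>v x) = B *\<^sub>v s" by simp
    moreover have "x \<in> carrier_vec n" using x by blast
    ultimately show "x = B *\<^sub>v s"
      using B M by (simp flip: assoc_mult_mat_vec[of B n n M n])
  qed
qed

section \<open>Vector arithmetic and coordinatewise convergence\<close>

lemma add_vec_eq_iff:
  fixes a b c :: "real vec"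
  assumes "a \<in> carrier_vec n" "b \<in> carrier_vec n" "c \<in> carrier_vec n"
  shows "a + b = c \<longleftrightarrow> a = c - b" and "b + a = c \<longleftrightarrow> a = c - b"
  using assms by (auto simp: vec_eq_iff algebra_simps)

lemma mult_mat_vec_uminus:
  fixes A :: "real mat"
  assumes "A \<in> carrier_mat nr nc" and "v \<in> carrier_vec nc"
  shows "A *\<^sub>v (- v) = - (A *\<^sub>v v)"
  using assms by (intro eq_vecI) auto

lemma mult_mat_zero_vec:
  assumes "A \<in> carrier_mat nr nc"
  shows "A *\<^sub>v 0\<^sub>v nc = 0\<^sub>v nr"
  using assms by (intro eq_vecI) auto

text \<open>Both half steps of the iteration are affine maps of this shape; in a difference the
  right-hand side \<open>r\<close> cancels.\<close>

lemma mult_mat_vec_affine_diff: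
  fixes B M :: "real mat"
  assumes B: "B \<in> carrier_mat k l" and M: "M \<in> carrier_mat l m" and r: "r \<in> carrier_vec l"
    and x: "x \<in> carrier_vec m" and y: "y \<in> carrier_vec m"
  shows "B *\<^sub>v (r - M *\<^sub>v x) - B *\<^sub>v (r - M *\<^sub>v y) = - (B *\<^sub>v (M *\<^sub>v (x - y)))"
proof -
  have Mx: "M *\<^sub>v x \<in> carrier_vec l" "M *\<^sub>v y \<in> carrier_vec l" using M x y by auto
  have "B *\<^sub>v (r - M *\<^sub>v x) - B *\<^sub>v (r - M *\<^sub>v y) = B *\<^sub>v ((r - M *\<^sub>v x) - (r - M *\<^sub>v y))"
    using B r Mx by (intro mult_minus_distrib_mat_vec[symmetric]) auto
  also have "(r - M *\<^sub>v x) - (r - M *\<^sub>v y) = M *\<^sub>v y - M *\<^sub>v x"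
    using r Mx by (intro eq_vecI) (auto simp del: index_mult_mat_vec)
  also have "B *\<^sub>v (M *\<^sub>v y - M *\<^sub>v x) = - (B *\<^sub>v (M *\<^sub>v x - M *\<^sub>v y))"
    unfolding mult_minus_distrib_mat_vec[OF B Mx] mult_minus_distrib_mat_vec[OF B Mx(2,1)]
    using B Mx by (intro eq_vecI) (auto simp del: index_mult_mat_vec)
  also have "M *\<^sub>v x - M *\<^sub>v y = M *\<^sub>v (x - y)"
    by (rule mult_minus_distrib_mat_vec[OF M x y, symmetric])
  finally show ?thesis .
qed

lemma mult_mat_inv_eq_iff:
  assumes K: "K \<in> carrier_mat m m" "invertible_mat K"
    and x: "x \<in> carrier_vec m" and y: "y \<in> carrier_vec m"
  shows "K *\<^sub>v x = y \<longleftrightarrow> x = mat_inv K *\<^sub>v y"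
proof -
  note J = mat_inv_inverse[OF K]
  have "mat_inv K *\<^sub>v (K *\<^sub>v x) = x"
    using J K x by (simp flip: assoc_mult_mat_vec[of "mat_inv K" m m K m])
  moreover have "K *\<^sub>v (mat_inv K *\<^sub>v y) = y"
    using J K y by (simp flip: assoc_mult_mat_vec[of K m m "mat_inv K" m])
  ultimately show ?thesis by auto
qed

lemma vec_tendsto_mult_mat_vec:
  assumes A: "A \<in> carrier_mat m n" and f: "vec_tendsto n f l"
    and fc: "\<And>j. f j \<in> carrier_vec n" and l: "l \<in> carrier_vec n"
  shows "vec_tendsto m (\<lambda>j. A *\<^sub>v f j) (A *\<^sub>v l)"
proof -
  have eq: "(A *\<^sub>v x) $ i = (\<Sum>k<n. A $$ (i, k) * x $ k)" if "i < m" "x \<in> carrier_vec n" for i x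
    using A that by (auto simp: scalar_prod_def atLeast0LessThan intro!: sum.cong)
  show ?thesis
    unfolding vec_tendsto_def
  proof (intro allI impI)
    fix i assume i: "i < m"
    have "(\<lambda>j. \<Sum>k<n. A $$ (i, k) * f j $ k) \<longlonglongrightarrow> (\<Sum>k<n. A $$ (i, k) * l $ k)"
      using f unfolding vec_tendsto_def by (intro tendsto_intros) auto
    thus "(\<lambda>j. (A *\<^sub>v f j) $ i) \<longlonglongrightarrow> (A *\<^sub>v l) $ i"
      using eq[OF i] fc l by simp
  qed
qed

lemma vec_tendsto_diff_iff:
  assumes "\<And>j. f j \<in> carrier_vec n" and "l \<in> carrier_vec n"
  shows "vec_tendsto n (\<lambda>j. f j - l) (0\<^sub>v n) \<longleftrightarrow> vec_tendsto n f l"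
  using assms LIM_zero_iff[of "\<lambda>j. f j $ i" "l $ i" sequentially for i]
  unfolding vec_tendsto_def by simp

text \<open>Serves to discard \<open>w2 0\<close>, about which the iteration says nothing.\<close>

lemma vec_tendsto_Suc_iff: "vec_tendsto n (\<lambda>j. f (Suc j)) l \<longleftrightarrow> vec_tendsto n f l"
  unfolding vec_tendsto_def by (simp add: filterlim_sequentially_Suc[of "\<lambda>j. f j $ i" for i])

section \<open>Two coupled blocks and their Gauss-Seidel iteration\<close>

lemma ex1_pair_fst_eq: "(\<exists>!w. fst w = g (snd w) \<and> F (snd w)) \<longleftrightarrow> (\<exists>!x. F x)"
proof
  assume "\<exists>!w. fst w = g (snd w) \<and> F (snd w)"
  thus "\<exists>!x. F x" by (metis fst_conv snd_conv)
next
  assume "\<exists>!x. F x"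
  thus "\<exists>!w. fst w = g (snd w) \<and> F (snd w)" by (metis fst_conv prod.collapse snd_conv)
qed

text \<open>Abstracts from the KKT blocks to two invertible matrices coupled by \<open>L\<close> and
  its transpose. Positive sizes keep the spectra nonempty, so that the spectral radius is a genuine
  maximum.\<close>

locale coupled_system =
  fixes m1 m2 :: nat and K1 K2 L :: "real mat" and r1 r2 :: "real vec"
  assumes m1: "m1 > 0" and m2: "m2 > 0"
    and K1: "K1 \<in> carrier_mat m1 m1" and K2: "K2 \<in> carrier_mat m2 m2"
    and L: "L \<in> carrier_mat m1 m2"
    and r1: "r1 \<in> carrier_vec m1" and r2: "r2 \<in> carrier_vec m2"
    and inv1: "invertible_mat K1" and inv2: "invertible_mat K2"
begin

abbreviation "J1 \<equiv> mat_inv K1"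
abbreviation "J2 \<equiv> mat_inv K2"
abbreviation "T \<equiv> transpose_mat L"

text \<open>The digit names the block on which the matrix acts: \<open>gs_mat2\<close> is \<Gamma>
  and \<open>gs_mat1\<close> is its counterpart with a tilde.\<close>

definition gs_mat2 :: "real mat" where "gs_mat2 = J2 * T * J1 * L"
definition gs_mat1 :: "real mat" where "gs_mat1 = J1 * L * J2 * T"

lemma J1: "J1 \<in> carrier_mat m1 m1" and J2: "J2 \<in> carrier_mat m2 m2"
  using mat_inv_inverse(1) K1 K2 inv1 inv2 by auto

lemma T: "T \<in> carrier_mat m2 m1"
  using L by simp

lemma gs_mat2_carrier: "gs_mat2 \<in> carrier_mat m2 m2" and gs_mat1_carrier: "gs_mat1 \<in> carrier_mat m1 m1"
  unfolding gs_mat2_def gs_mat1_def using J1 J2 T L by (auto intro!: mult_carrier_mat)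

lemma gs_mat2_mult_vec:
  assumes "x \<in> carrier_vec m2"
  shows "gs_mat2 *\<^sub>v x = J2 *\<^sub>v (T *\<^sub>v (J1 *\<^sub>v (L *\<^sub>v x)))"
  unfolding gs_mat2_def
  by (simp add: assoc_mult_mat_vec[OF mult_carrier_mat[OF mult_carrier_mat[OF J2 T] J1] L assms]
      assoc_mult_mat_vec[OF mult_carrier_mat[OF J2 T] J1] assoc_mult_mat_vec[OF J2 T]
      mult_mat_vec_carrier[OF L assms] mult_mat_vec_carrier[OF J1])

lemma gs_mat1_mult_vec:
  assumes "x \<in> carrier_vec m1"
  shows "gs_mat1 *\<^sub>v x = J1 *\<^sub>v (L *\<^sub>v (J2 *\<^sub>v (T *\<^sub>v x)))"
  unfolding gs_mat1_def
  by (simp add: assoc_mult_mat_vec[OF mult_carrier_mat[OF mult_carrier_mat[OF J1 L] J2] T assms]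
      assoc_mult_mat_vec[OF mult_carrier_mat[OF J1 L] J2] assoc_mult_mat_vec[OF J1 L]
      mult_mat_vec_carrier[OF T assms] mult_mat_vec_carrier[OF J2])

lemma spectral_radius_eq: "complex_spectral_radius gs_mat2 = complex_spectral_radius gs_mat1"
proof -
  have "gs_mat2 = (J2 * T) * (J1 * L)" "gs_mat1 = (J1 * L) * (J2 * T)"
    unfolding gs_mat2_def gs_mat1_def
    by (rule assoc_mult_mat[OF mult_carrier_mat[OF J2 T] J1 L],
        rule assoc_mult_mat[OF mult_carrier_mat[OF J1 L] J2 T])
  thus ?thesis
    using complex_spectral_radius_mult_commute[of "J2 * T" m2 m1 "J1 * L"] J1 J2 T L m1 m2 by simp
qed

text \<open>Inverting the diagonal block in each row exhibits the solutions as the stationary points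
  of the iteration, the form needed for the error equations.\<close>

lemma solves_system_iff:
  "solves_system K1 K2 L r1 r2 w1 w2 \<longleftrightarrow> w1 \<in> carrier_vec m1 \<and> w2 \<in> carrier_vec m2
    \<and> w1 = J1 *\<^sub>v (r1 - L *\<^sub>v w2) \<and> w2 = J2 *\<^sub>v (r2 - T *\<^sub>v w1)"
proof -
  have "four_block_mat K1 L T K2 *\<^sub>v (w1 @\<^sub>v w2) = r1 @\<^sub>v r2
      \<longleftrightarrow> w1 = J1 *\<^sub>v (r1 - L *\<^sub>v w2) \<and> w2 = J2 *\<^sub>v (r2 - T *\<^sub>v w1)"
    if w: "w1 \<in> carrier_vec m1" "w2 \<in> carrier_vec m2"
  proof -
    have c: "K1 *\<^sub>v w1 \<in> carrier_vec m1" "L *\<^sub>v w2 \<in> carrier_vec m1"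
      "T *\<^sub>v w1 \<in> carrier_vec m2" "K2 *\<^sub>v w2 \<in> carrier_vec m2"
      using K1 K2 L T w by (auto intro: mult_mat_vec_carrier)
    have "four_block_mat K1 L T K2 *\<^sub>v (w1 @\<^sub>v w2)
        = (K1 *\<^sub>v w1 + L *\<^sub>v w2) @\<^sub>v (T *\<^sub>v w1 + K2 *\<^sub>v w2)"
      by (rule four_block_mat_mult_vec[OF K1 L T K2 w])
    also have "\<dots> = r1 @\<^sub>v r2 \<longleftrightarrow> K1 *\<^sub>v w1 + L *\<^sub>v w2 = r1 \<and> T *\<^sub>v w1 + K2 *\<^sub>v w2 = r2"
      by (rule append_vec_eq[of _ m1]) (use c r1 in auto)
    also have "\<dots> \<longleftrightarrow> K1 *\<^sub>v w1 = r1 - L *\<^sub>v w2 \<and> K2 *\<^sub>v w2 = r2 - T *\<^sub>v w1"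
      using add_vec_eq_iff(1)[OF c(1,2) r1] add_vec_eq_iff(2)[OF c(4,3) r2] by simp
    also have "\<dots> \<longleftrightarrow> w1 = J1 *\<^sub>v (r1 - L *\<^sub>v w2) \<and> w2 = J2 *\<^sub>v (r2 - T *\<^sub>v w1)"
      using mult_mat_inv_eq_iff[OF K1 inv1 w(1)] mult_mat_inv_eq_iff[OF K2 inv2 w(2)] c r1 r2 by simp
    finally show ?thesis .
  qed
  thus ?thesis using K1 K2 unfolding solves_system_def by auto
qed

text \<open>Eliminating \<open>w1\<close> from the second equation: the minus signs of the two rows
  cancel, so \<open>gs_mat2\<close> enters with a plus sign.\<close>

lemma solves_system_iff_fixed_point:
  "solves_system K1 K2 L r1 r2 w1 w2 \<longleftrightarrow> w1 = J1 *\<^sub>v (r1 - L *\<^sub>v w2)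
    \<and> w2 \<in> carrier_vec m2 \<and> w2 = J2 *\<^sub>v (r2 - T *\<^sub>v (J1 *\<^sub>v r1)) + gs_mat2 *\<^sub>v w2"
proof -
  have "J2 *\<^sub>v (r2 - T *\<^sub>v (J1 *\<^sub>v (r1 - L *\<^sub>v w2))) = J2 *\<^sub>v (r2 - T *\<^sub>v (J1 *\<^sub>v r1)) + gs_mat2 *\<^sub>v w2"
    if w: "w2 \<in> carrier_vec m2" for w2
  proof -
    have Lw: "L *\<^sub>v w2 \<in> carrier_vec m1" using L w by simp
    hence J: "J1 *\<^sub>v r1 \<in> carrier_vec m1" "J1 *\<^sub>v (L *\<^sub>v w2) \<in> carrier_vec m1" using J1 r1 by auto
    hence t: "T *\<^sub>v (J1 *\<^sub>v r1) \<in> carrier_vec m2" "T *\<^sub>v (J1 *\<^sub>v (L *\<^sub>v w2)) \<in> carrier_vec m2"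
      using T by auto
    have "r2 - T *\<^sub>v (J1 *\<^sub>v (r1 - L *\<^sub>v w2))
        = r2 - (T *\<^sub>v (J1 *\<^sub>v r1) - T *\<^sub>v (J1 *\<^sub>v (L *\<^sub>v w2)))"
      by (simp only: mult_minus_distrib_mat_vec[OF J1 r1 Lw] mult_minus_distrib_mat_vec[OF T J])
    also have "\<dots> = (r2 - T *\<^sub>v (J1 *\<^sub>v r1)) + T *\<^sub>v (J1 *\<^sub>v (L *\<^sub>v w2))"
      using r2 t by (intro eq_vecI) (auto simp del: index_mult_mat_vec)
    finally show ?thesis
      using mult_add_distrib_mat_vec[OF J2 _ t(2)] r2 t gs_mat2_mult_vec[OF w] by simp
  qed
  hence "w2 = J2 *\<^sub>v (r2 - T *\<^sub>v w1) \<longleftrightarrow> w2 = J2 *\<^sub>v (r2 - T *\<^sub>v (J1 *\<^sub>v r1)) + gs_mat2 *\<^sub>v w2"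
    if "w2 \<in> carrier_vec m2" "w1 = J1 *\<^sub>v (r1 - L *\<^sub>v w2)"
    unfolding that(2) using that(1) by presburger
  moreover have "w1 \<in> carrier_vec m1" if "w1 = J1 *\<^sub>v (r1 - L *\<^sub>v w2)"
    unfolding that using J1 by (intro carrier_vecI) simp
  ultimately show ?thesis unfolding solves_system_iff by blast
qed

theorem ex1_solution_iff:
  "(\<exists>!w. solves_system K1 K2 L r1 r2 (fst w) (snd w)) \<longleftrightarrow> 1 \<notin> complex_spectrum gs_mat2"
proof -
  define s where "s = J2 *\<^sub>v (r2 - T *\<^sub>v (J1 *\<^sub>v r1))"
  have s: "s \<in> carrier_vec m2" unfolding s_def using J2 by (intro carrier_vecI) simp
  define F where "F x \<longleftrightarrow> x \<in> carrier_vec m2 \<and> x = s + gs_mat2 *\<^sub>v x" for x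
  define g where "g x = J1 *\<^sub>v (r1 - L *\<^sub>v x)" for x
  have "solves_system K1 K2 L r1 r2 w1 w2 \<longleftrightarrow> w1 = g w2 \<and> F w2" for w1 w2
    unfolding F_def g_def s_def by (rule solves_system_iff_fixed_point)
  \<comment> \<open>The first component of a solution is a function of the second, so counting pairs
    reduces to counting fixed points.\<close>
  hence "(\<exists>!w. solves_system K1 K2 L r1 r2 (fst w) (snd w)) \<longleftrightarrow> (\<exists>!x. F x)"
    by (simp add: ex1_pair_fst_eq)
  also have "\<dots> \<longleftrightarrow> 1 \<notin> complex_spectrum gs_mat2"
    unfolding F_def by (rule ex1_fixed_point_iff[OF gs_mat2_carrier s])
  finally show ?thesis .
qed

lemma block_gauss_seidel_carrier:
  assumes "block_gauss_seidel K1 K2 L r1 r2 w1 w2"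
  shows "w1 j \<in> carrier_vec m1" and "w2 (Suc j) \<in> carrier_vec m2"
proof -
  have c: "J1 *\<^sub>v x \<in> carrier_vec m1" "J2 *\<^sub>v y \<in> carrier_vec m2" for x y
    using J1 J2 by (auto intro: carrier_vecI)
  show "w1 j \<in> carrier_vec m1"
    using assms K1 c(1) unfolding block_gauss_seidel_def by (cases j) (simp, metis)
  show "w2 (Suc j) \<in> carrier_vec m2"
    using assms c(2) unfolding block_gauss_seidel_def by metis
qed

lemma ex_block_gauss_seidel:
  assumes "x \<in> carrier_vec m1"
  obtains w1 w2 where "block_gauss_seidel K1 K2 L r1 r2 w1 w2" and "w1 0 = x"
proof
  define w1 where
    "w1 = rec_nat x (\<lambda>_ w. J1 *\<^sub>v (r1 - L *\<^sub>v (J2 *\<^sub>v (r2 - T *\<^sub>v w))))"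
  show "w1 0 = x" by (simp add: w1_def)
  \<comment> \<open>At \<open>Suc j\<close> the index \<open>j - 1\<close> becomes \<open>j\<close>,
    as the scheme demands; at 0 truncated subtraction gives some harmless value.\<close>
  show "block_gauss_seidel K1 K2 L r1 r2 w1 (\<lambda>j. J2 *\<^sub>v (r2 - T *\<^sub>v w1 (j - 1)))"
    using assms K1 unfolding block_gauss_seidel_def by (simp add: w1_def)
qed

section \<open>Propagation of the error\<close>

context
  fixes ws1 ws2 :: "real vec"
  assumes sol: "solves_system K1 K2 L r1 r2 ws1 ws2"
begin

lemma ws: "ws1 \<in> carrier_vec m1" "ws2 \<in> carrier_vec m2"
  "ws1 = J1 *\<^sub>v (r1 - L *\<^sub>v ws2)" "ws2 = J2 *\<^sub>v (r2 - T *\<^sub>v ws1)"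
  using sol unfolding solves_system_iff by blast+

lemma w2_error:
  assumes gs: "block_gauss_seidel K1 K2 L r1 r2 w1 w2"
  shows "w2 (Suc j) - ws2 = - (J2 * T) *\<^sub>v (w1 j - ws1)"
proof -
  note w = block_gauss_seidel_carrier[OF gs]
  have "w2 (Suc j) - ws2 = J2 *\<^sub>v (r2 - T *\<^sub>v w1 j) - J2 *\<^sub>v (r2 - T *\<^sub>v ws1)"
    using gs ws(4) unfolding block_gauss_seidel_def by metis
  also have "\<dots> = - (J2 *\<^sub>v (T *\<^sub>v (w1 j - ws1)))"
    by (rule mult_mat_vec_affine_diff[OF J2 T r2 w(1) ws(1)])
  also have "\<dots> = - (J2 * T) *\<^sub>v (w1 j - ws1)"
    using J2 T w(1)[of j] ws(1) by (simp add: assoc_mult_mat_vec[OF J2 T])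
  finally show ?thesis .
qed

text \<open>Inserting the error of the fresh \<open>w2\<close> into the first half step produces a
  second minus sign, which cancels the one in \<open>w2_error\<close>.\<close>

lemma w1_error:
  assumes gs: "block_gauss_seidel K1 K2 L r1 r2 w1 w2"
  shows "w1 (Suc j) - ws1 = gs_mat1 *\<^sub>v (w1 j - ws1)"
proof -
  note w = block_gauss_seidel_carrier[OF gs]
  define d where "d = w1 j - ws1"
  have d: "d \<in> carrier_vec m1" using w(1)[of j] ws(1) by (simp add: d_def)
  hence Td: "J2 *\<^sub>v (T *\<^sub>v d) \<in> carrier_vec m2" using J2 T by simp
  have "w1 (Suc j) - ws1 = J1 *\<^sub>v (r1 - L *\<^sub>v w2 (Suc j)) - J1 *\<^sub>v (r1 - L *\<^sub>v ws2)"
    using gs ws(3) unfolding block_gauss_seidel_def by metis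
  also have "\<dots> = - (J1 *\<^sub>v (L *\<^sub>v (w2 (Suc j) - ws2)))"
    by (rule mult_mat_vec_affine_diff[OF J1 L r1 w(2) ws(2)])
  also have "w2 (Suc j) - ws2 = - (J2 *\<^sub>v (T *\<^sub>v d))"
    using J2 T d unfolding w2_error[OF gs] d_def[symmetric]
    by (simp add: assoc_mult_mat_vec[OF J2 T])
  also have "J1 *\<^sub>v (L *\<^sub>v (- (J2 *\<^sub>v (T *\<^sub>v d)))) = - (J1 *\<^sub>v (L *\<^sub>v (J2 *\<^sub>v (T *\<^sub>v d))))"
    using mult_mat_vec_uminus[OF L Td] mult_mat_vec_uminus[OF J1] mult_mat_vec_carrier[OF L Td]
    by simp
  finally show ?thesis using gs_mat1_mult_vec[OF d] by (simp add: d_def)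
qed

lemma w1_error_pow:
  assumes gs: "block_gauss_seidel K1 K2 L r1 r2 w1 w2"
  shows "w1 j - ws1 = gs_mat1 ^\<^sub>m j *\<^sub>v (w1 0 - ws1)"
proof -
  have d: "w1 0 - ws1 \<in> carrier_vec m1"
    using block_gauss_seidel_carrier(1)[OF gs, of 0] ws(1) by simp
  \<comment> \<open>\<open>^\<^sub>m\<close> multiplies by the new factor on the right, whereas the
    error recursion supplies it on the left.\<close>
  have pow_Suc: "gs_mat1 * gs_mat1 ^\<^sub>m j = gs_mat1 ^\<^sub>m Suc j" for j
  proof (induction j)
    case 0
    show ?case using gs_mat1_carrier by simp
  next
    case (Suc j)
    have "gs_mat1 * gs_mat1 ^\<^sub>m Suc j = (gs_mat1 * gs_mat1 ^\<^sub>m j) * gs_mat1"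
      using gs_mat1_carrier by (simp add: assoc_mult_mat[of _ m1 m1 _ m1 _ m1])
    thus ?case unfolding Suc by simp
  qed
  show ?thesis
  proof (induction j)
    case 0
    show ?case using d gs_mat1_carrier by simp
  next
    case (Suc j)
    have "w1 (Suc j) - ws1 = (gs_mat1 * gs_mat1 ^\<^sub>m j) *\<^sub>v (w1 0 - ws1)"
      unfolding w1_error[OF gs] Suc
      by (rule assoc_mult_mat_vec[OF gs_mat1_carrier pow_carrier_mat[OF gs_mat1_carrier] d, symmetric])
    thus ?case unfolding pow_Suc .
  qed
qed

theorem block_gauss_seidel_converges_iff:
  "(\<forall>w1 w2. block_gauss_seidel K1 K2 L r1 r2 w1 w2 \<longrightarrow>
      vec_tendsto m1 w1 ws1 \<and> vec_tendsto m2 w2 ws2)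
    \<longleftrightarrow> complex_spectral_radius gs_mat1 < 1" (is "?conv \<longleftrightarrow> _")
proof
  assume conv: ?conv
  show "complex_spectral_radius gs_mat1 < 1"
  proof (rule spectral_radius_less_1_if_vec_tendsto_0[OF gs_mat1_carrier m1])
    fix x :: "real vec" assume x: "x \<in> carrier_vec m1"
    \<comment> \<open>Starting at \<open>x + ws1\<close> makes \<open>x\<close> the initial error,
      so every vector occurs as an initial error.\<close>
    obtain w1 w2 where gs: "block_gauss_seidel K1 K2 L r1 r2 w1 w2" and "w1 0 = x + ws1"
      using ex_block_gauss_seidel[of "x + ws1"] x ws(1) by auto
    hence "w1 0 - ws1 = x" using x ws(1) by (auto intro!: eq_vecI)
    hence "gs_mat1 ^\<^sub>m j *\<^sub>v x = w1 j - ws1" for j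
      using w1_error_pow[OF gs, of j] by simp
    moreover have "vec_tendsto m1 (\<lambda>j. w1 j - ws1) (0\<^sub>v m1)"
      using conv gs vec_tendsto_diff_iff[of w1, OF block_gauss_seidel_carrier(1)[OF gs] ws(1)]
      by blast
    ultimately show "vec_tendsto m1 (\<lambda>j. gs_mat1 ^\<^sub>m j *\<^sub>v x) (0\<^sub>v m1)" by simp
  qed
next
  assume rho: "complex_spectral_radius gs_mat1 < 1"
  show ?conv
  proof (intro allI impI conjI)
    fix w1 w2 assume gs: "block_gauss_seidel K1 K2 L r1 r2 w1 w2"
    note w = block_gauss_seidel_carrier[OF gs]
    have d: "w1 j - ws1 \<in> carrier_vec m1" for j using w(1)[of j] ws(1) by simp
    have lim1: "vec_tendsto m1 (\<lambda>j. w1 j - ws1) (0\<^sub>v m1)"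
      using vec_tendsto_0_if_spectral_radius_less_1[OF gs_mat1_carrier m1 d[of 0] rho]
      unfolding w1_error_pow[OF gs, symmetric] .
    thus "vec_tendsto m1 w1 ws1" using vec_tendsto_diff_iff[of w1, OF w(1) ws(1)] by blast
    \<comment> \<open>The error of \<open>w2\<close> at \<open>Suc j\<close> is a fixed linear image
      of the error of \<open>w1\<close> at \<open>j\<close> and so inherits its limit 0.\<close>
    have M: "- (J2 * T) \<in> carrier_mat m2 m1" using J2 T by simp
    have "- (J2 * T) *\<^sub>v 0\<^sub>v m1 = 0\<^sub>v m2" by (rule mult_mat_zero_vec[OF M])
    hence "vec_tendsto m2 (\<lambda>j. w2 (Suc j) - ws2) (0\<^sub>v m2)"
      using vec_tendsto_mult_mat_vec[OF M lim1 d] unfolding w2_error[OF gs] by simp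
    thus "vec_tendsto m2 w2 ws2"
      using vec_tendsto_diff_iff[of "\<lambda>j. w2 (Suc j)", OF w(2) ws(2)] vec_tendsto_Suc_iff by blast
  qed
qed

end

end

section \<open>Application to the KKT system\<close>

lemma kkt_mat_carrier:
  assumes "P \<in> carrier_mat n n" and "A \<in> carrier_mat p n"
  shows "kkt_mat P A \<in> carrier_mat (n + p) (n + p)"
  using assms unfolding kkt_mat_def by auto

lemma pad_cols_carrier:
  assumes "C \<in> carrier_mat m n"
  shows "pad_cols C k \<in> carrier_mat m (n + k)"
  using assms unfolding pad_cols_def carrier_mat_def by auto

theorem proposition3:
  fixes n1 n2 p1 p2 :: nat
    and P1 P2 A1 A2 N1 M1 K1 K2 C L \<Gamma> \<Gamma>t :: "real mat"
    and q1 q2 b1 b2 r1 r2 :: "real vec"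
  assumes "n1 > 0" and "n2 > 0"
    and "psd_mat n1 P1" and "psd_mat n2 P2"
    and "A1 \<in> carrier_mat p1 n1" and "A2 \<in> carrier_mat p2 n2"
    and "N1 \<in> carrier_mat n1 n2" and "M1 \<in> carrier_mat p1 n2"
    and "q1 \<in> carrier_vec n1" and "q2 \<in> carrier_vec n2"
    and "b1 \<in> carrier_vec p1" and "b2 \<in> carrier_vec p2"
    and "K1 = kkt_mat P1 A1" and "K2 = kkt_mat P2 A2"
    and "r1 = (- q1) @\<^sub>v b1" and "r2 = (- q2) @\<^sub>v b2"
    and "C = N1 @\<^sub>r M1" and "L = pad_cols C p2"
    and "invertible_mat K1" and "invertible_mat K2"
    and "\<Gamma> = mat_inv K2 * transpose_mat L * mat_inv K1 * L"
    and "\<Gamma>t = mat_inv K1 * L * mat_inv K2 * transpose_mat L"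
  shows "((\<exists>!w. solves_system K1 K2 L r1 r2 (fst w) (snd w)) \<longleftrightarrow> 1 \<notin> complex_spectrum \<Gamma>)
    \<and> complex_spectral_radius \<Gamma> = complex_spectral_radius \<Gamma>t
    \<and> (1 \<notin> complex_spectrum \<Gamma> \<longrightarrow>
        (\<forall>ws1 ws2. solves_system K1 K2 L r1 r2 ws1 ws2 \<longrightarrow>
            (\<forall>w1 w2. block_gauss_seidel K1 K2 L r1 r2 w1 w2 \<longrightarrow>
               (\<forall>j. w1 (Suc j) - ws1 = \<Gamma>t *\<^sub>v (w1 j - ws1)
                  \<and> w2 (Suc j) - ws2 = (- (mat_inv K2 * transpose_mat L)) *\<^sub>v (w1 j - ws1)))
          \<and> ((\<forall>w1 w2. block_gauss_seidel K1 K2 L r1 r2 w1 w2 \<longrightarrow>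
                vec_tendsto (n1 + p1) w1 ws1 \<and> vec_tendsto (n2 + p2) w2 ws2)
              \<longleftrightarrow> complex_spectral_radius \<Gamma> < 1)
          \<and> (\<forall>N. vec_norm_on (n1 + p1) N \<longrightarrow>
                (\<forall>w1 w2. block_gauss_seidel K1 K2 L r1 r2 w1 w2 \<longrightarrow>
                   (\<forall>j. N (w1 j - ws1) \<le> induced_norm (n1 + p1) N (\<Gamma>t ^\<^sub>m j) * N (w1 0 - ws1)))
              \<and> (\<lambda>j. induced_norm (n1 + p1) N (\<Gamma>t ^\<^sub>m j) powr (1 / real j))
                  \<longlonglongrightarrow> complex_spectral_radius \<Gamma>)))"
proof -
  have "P1 \<in> carrier_mat n1 n1" and "P2 \<in> carrier_mat n2 n2"
    using assms(3,4) unfolding psd_mat_def by auto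
  hence K: "K1 \<in> carrier_mat (n1 + p1) (n1 + p1)" "K2 \<in> carrier_mat (n2 + p2) (n2 + p2)"
    using assms by (auto intro: kkt_mat_carrier)
  have "C \<in> carrier_mat (n1 + p1) n2"
    unfolding \<open>C = N1 @\<^sub>r M1\<close> using assms(7,8) by (rule carrier_append_rows)
  hence L: "L \<in> carrier_mat (n1 + p1) (n2 + p2)"
    unfolding \<open>L = pad_cols C p2\<close> by (rule pad_cols_carrier)
  interpret coupled_system "n1 + p1" "n2 + p2" K1 K2 L r1 r2
    by unfold_locales (use assms K L in auto)
  have \<Gamma>: "\<Gamma> = gs_mat2" and \<Gamma>t: "\<Gamma>t = gs_mat1"
    using assms unfolding gs_mat2_def gs_mat1_def by auto
  show ?thesis
    unfolding \<Gamma> \<Gamma>t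
  proof (intro conjI impI allI)
    show "(\<exists>!w. solves_system K1 K2 L r1 r2 (fst w) (snd w)) \<longleftrightarrow> 1 \<notin> complex_spectrum gs_mat2"
      by (rule ex1_solution_iff)
    show "complex_spectral_radius gs_mat2 = complex_spectral_radius gs_mat1"
      by (rule spectral_radius_eq)
    fix ws1 ws2
    assume sol: "solves_system K1 K2 L r1 r2 ws1 ws2"
    show "(\<forall>w1 w2. block_gauss_seidel K1 K2 L r1 r2 w1 w2 \<longrightarrow>
          vec_tendsto (n1 + p1) w1 ws1 \<and> vec_tendsto (n2 + p2) w2 ws2)
        \<longleftrightarrow> complex_spectral_radius gs_mat2 < 1"
      \<comment> \<open>The errors are governed by \<open>gs_mat1\<close>, while the claim speaks of
        the radius of \<open>gs_mat2\<close>; the two radii agree.\<close>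
      unfolding spectral_radius_eq by (rule block_gauss_seidel_converges_iff[OF sol])
    show "w1 (Suc j) - ws1 = gs_mat1 *\<^sub>v (w1 j - ws1)"
      and "w2 (Suc j) - ws2 = - (mat_inv K2 * transpose_mat L) *\<^sub>v (w1 j - ws1)"
      if "block_gauss_seidel K1 K2 L r1 r2 w1 w2" for w1 w2 j
      using w1_error[OF sol that] w2_error[OF sol that] by blast+
    fix N assume N: "vec_norm_on (n1 + p1) N"
    show "(\<lambda>j. induced_norm (n1 + p1) N (gs_mat1 ^\<^sub>m j) powr (1 / real j))
        \<longlonglongrightarrow> complex_spectral_radius gs_mat2"
      unfolding spectral_radius_eq by (rule gelfand_formula[OF gs_mat1_carrier m1 N])
    show "N (w1 j - ws1) \<le> induced_norm (n1 + p1) N (gs_mat1 ^\<^sub>m j) * N (w1 0 - ws1)"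
      if gs: "block_gauss_seidel K1 K2 L r1 r2 w1 w2" for w1 w2 j
    proof -
      have "w1 0 - ws1 \<in> carrier_vec (n1 + p1)"
        using block_gauss_seidel_carrier(1)[OF gs, of 0] ws(1)[OF sol] by simp
      from vec_norm_mult_mat_vec_le_induced_norm[OF N pow_carrier_mat[OF gs_mat1_carrier] this]
      show ?thesis by (simp only: w1_error_pow[OF sol gs, symmetric])
    qed
  qed
qed

end
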